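(* Let $\Gamma=(X,\ast,t)$ be a pregeometry with type set $I$ all of whose rank 2 truncations are connected, and let $G\leq \operatorname{Aut}\Gamma$ be transitive on $X_i$ for every $i\in I$. Suppose that $\Gamma$ is $G$-primitive-basic. Then $\Gamma$ admits a unique decomposition $\Gamma=\Gamma_1\oplus\cdots\oplus\Gamma_\ell$ where, for each $i$, $\Gamma_i$ is indecomposable and the group $G^{\Gamma_i}$ induced by $G$ on the element set of $\Gamma_i$ is faithful and primitive on the set of elements of each type of $\Gamma_i$.
   Context: A pregeometry $\Gamma=(X,\ast,t)$ consists of a finite set $X$ of elements, a symmetric reflexive relation $\ast$ on $X$ (incidence), and a surjection $t:X\to I$ onto a set $I$ of types, such that if $x\ast y$ and $x\neq y$ then $t(x)\neq t(y)$. Write $X_i=t^{-1}(i)$. For nonempty $J\subseteq I$, the $J$-truncation $\Gamma_J$ has element set $t^{-1}(J)$ with the restricted incidence and type map. The incidence graph has vertex set $X$ and edges $\{x,y\}$ with $x\ast y$, $t(x)\ne t(y)$; "all rank 2 truncations connected" means that for all distinct $i,j\in I$ the incidence graph of $\Gamma_{\{i,j\}}$ is connected. An automorphism is a permutation $g$ of $X$ with $t(x^g)=t(x)$ and $x^g\ast y^g\iff x\ast y$. For a group $G$ acting on $Y$, $G^Y$ denotes the induced permutation group; the action is faithful if its kernel is trivial. $\Gamma$ is $G$-primitive-basic if $|X_i|\geq 2$ for every $i\in I$ and $G^{X_i}$ is primitive on $X_i$ for every $i\in I$. Direct sum: if $\Gamma_1,\Gamma_2$ are pregeometries with disjoint element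 sets and disjoint type sets, $\Gamma_1\oplus\Gamma_2$ has element set and type set the disjoint unions, restricts to $\Gamma_1$ and $\Gamma_2$ on their element sets, and every element of $\Gamma_1$ is incident with every element of $\Gamma_2$. Writing $\Gamma=\Gamma_1\oplus\cdots\oplus\Gamma_\ell$ means $I$ is partitioned into $I_1,\dots,I_\ell$ with $\Gamma_i$ the $I_i$-truncation and elements of types in different parts always incident. $\Gamma$ is decomposable if $\Gamma=\Gamma_1\oplus\Gamma_2$ for some (nonempty) $\Gamma_1,\Gamma_2$, and indecomposable otherwise. *)

theory Defs
  imports "HOL-Algebra.Group_Action" "HOL-Library.Disjoint_Sets"
begin

section \<open>Primitive group actions\<close>

text \<open>A partition is invariant if every group element maps blocks to blocks.\<close>

locale primitive_action = transitive_action +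
  assumes primitive:
    "\<lbrakk> partition_on E P; \<And>g B. \<lbrakk> g \<in> carrier G; B \<in> P \<rbrakk> \<Longrightarrow> \<phi> g ` B \<in> P \<rbrakk>
      \<Longrightarrow> P = {E} \<or> P = (\<lambda>x. {x}) ` E"


section \<open>Pregeometries\<close>

record ('a, 'i) pregeom =
  elems :: "'a set"
  types :: "'i set"
  incid :: "('a \<times> 'a) set"
  type_of :: "'a \<Rightarrow> 'i"

text \<open>The incidence relation lives on the element set and the type map is extensional, so that
  two pregeometries with the same elements, types, incidences and types of elements are equal
  as records.\<close>

definition pregeometry :: "('a, 'i) pregeom \<Rightarrow> bool" where
  "pregeometry \<Gamma> \<longleftrightarrow>
     finite (elems \<Gamma>) \<and>
     incid \<Gamma> \<subseteq> elems \<Gamma> \<times> elems \<Gamma> \<and>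
     refl_on (elems \<Gamma>) (incid \<Gamma>) \<and>
     sym (incid \<Gamma>) \<and>
     type_of \<Gamma> \<in> extensional (elems \<Gamma>) \<and>
     type_of \<Gamma> ` elems \<Gamma> = types \<Gamma> \<and>
     (\<forall>x y. (x, y) \<in> incid \<Gamma> \<and> x \<noteq> y \<longrightarrow> type_of \<Gamma> x \<noteq> type_of \<Gamma> y)"

definition elems_of_type :: "('a, 'i) pregeom \<Rightarrow> 'i \<Rightarrow> 'a set" where
  "elems_of_type \<Gamma> i = {x \<in> elems \<Gamma>. type_of \<Gamma> x = i}"

definition truncation :: "('a, 'i) pregeom \<Rightarrow> 'i set \<Rightarrow> ('a, 'i) pregeom" where
  "truncation \<Gamma> J =
     (let Y = {x \<in> elems \<Gamma>. type_of \<Gamma> x \<in> J}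
      in \<lparr>elems = Y, types = J, incid = incid \<Gamma> \<inter> Y \<times> Y, type_of = restrict (type_of \<Gamma>) Y\<rparr>)"

definition incidence_edges :: "('a, 'i) pregeom \<Rightarrow> ('a \<times> 'a) set" where
  "incidence_edges \<Gamma> = {(x, y) \<in> incid \<Gamma>. type_of \<Gamma> x \<noteq> type_of \<Gamma> y}"

definition incidence_graph_connected :: "('a, 'i) pregeom \<Rightarrow> bool" where
  "incidence_graph_connected \<Gamma> \<longleftrightarrow>
     (\<forall>x\<in>elems \<Gamma>. \<forall>y\<in>elems \<Gamma>. (x, y) \<in> (incidence_edges \<Gamma>)\<^sup>*)"

definition rank2_truncations_connected :: "('a, 'i) pregeom \<Rightarrow> bool" where
  "rank2_truncations_connected \<Gamma> \<longleftrightarrow>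
     (\<forall>i\<in>types \<Gamma>. \<forall>j\<in>types \<Gamma>. i \<noteq> j \<longrightarrow> incidence_graph_connected (truncation \<Gamma> {i, j}))"


section \<open>Automorphisms and induced permutation groups\<close>

definition Aut :: "('a, 'i) pregeom \<Rightarrow> ('a \<Rightarrow> 'a) monoid" where
  "Aut \<Gamma> = (BijGroup (elems \<Gamma>))
     \<lparr>carrier := {g \<in> Bij (elems \<Gamma>).
        (\<forall>x\<in>elems \<Gamma>. type_of \<Gamma> (g x) = type_of \<Gamma> x) \<and>
        (\<forall>x\<in>elems \<Gamma>. \<forall>y\<in>elems \<Gamma>. (g x, g y) \<in> incid \<Gamma> \<longleftrightarrow> (x, y) \<in> incid \<Gamma>)}\<rparr>"

text \<open>For a set \<open>G\<close> of permutations leaving \<open>Y\<close> invariant, this is the permutation group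
  \<open>G\<^sup>Y\<close> induced on \<open>Y\<close>. A permutation group acts on an invariant set \<open>Z\<close> by
  restricting its elements to \<open>Z\<close>.\<close>

definition induced_group :: "('a \<Rightarrow> 'a) set \<Rightarrow> 'a set \<Rightarrow> ('a \<Rightarrow> 'a) monoid" where
  "induced_group G Y = (BijGroup Y)\<lparr>carrier := (\<lambda>g. restrict g Y) ` G\<rparr>"

abbreviation restr_action :: "'a set \<Rightarrow> ('a \<Rightarrow> 'a) \<Rightarrow> ('a \<Rightarrow> 'a)" where
  "restr_action Z \<equiv> (\<lambda>g. restrict g Z)"

definition primitive_basic :: "('a \<Rightarrow> 'a) set \<Rightarrow> ('a, 'i) pregeom \<Rightarrow> bool" where
  "primitive_basic G \<Gamma> \<longleftrightarrow>
     (\<forall>i\<in>types \<Gamma>. card (elems_of_type \<Gamma> i) \<ge> 2 \<and>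
        primitive_action (induced_group G (elems_of_type \<Gamma> i)) (elems_of_type \<Gamma> i)
          (restr_action (elems_of_type \<Gamma> i)))"


section \<open>Direct sums\<close>

text \<open>Only meaningful if the element sets and the type sets are disjoint.\<close>

definition direct_sum ::
    "('a, 'i) pregeom \<Rightarrow> ('a, 'i) pregeom \<Rightarrow> ('a, 'i) pregeom" where
  "direct_sum \<Gamma>\<^sub>1 \<Gamma>\<^sub>2 =
     \<lparr>elems = elems \<Gamma>\<^sub>1 \<union> elems \<Gamma>\<^sub>2,
      types = types \<Gamma>\<^sub>1 \<union> types \<Gamma>\<^sub>2,
      incid = incid \<Gamma>\<^sub>1 \<union> incid \<Gamma>\<^sub>2 \<union> elems \<Gamma>\<^sub>1 \<times> elems \<Gamma>\<^sub>2 \<union> elems \<Gamma>\<^sub>2 \<times> elems \<Gamma>\<^sub>1,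
      type_of = (\<lambda>x\<in>elems \<Gamma>\<^sub>1 \<union> elems \<Gamma>\<^sub>2.
        if x \<in> elems \<Gamma>\<^sub>1 then type_of \<Gamma>\<^sub>1 x else type_of \<Gamma>\<^sub>2 x)\<rparr>"

definition decomposable :: "('a, 'i) pregeom \<Rightarrow> bool" where
  "decomposable \<Gamma> \<longleftrightarrow>
     (\<exists>\<Gamma>\<^sub>1 \<Gamma>\<^sub>2. pregeometry \<Gamma>\<^sub>1 \<and> pregeometry \<Gamma>\<^sub>2 \<and>
        elems \<Gamma>\<^sub>1 \<noteq> {} \<and> elems \<Gamma>\<^sub>2 \<noteq> {} \<and>
        elems \<Gamma>\<^sub>1 \<inter> elems \<Gamma>\<^sub>2 = {} \<and> types \<Gamma>\<^sub>1 \<inter> types \<Gamma>\<^sub>2 = {} \<and>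
        \<Gamma> = direct_sum \<Gamma>\<^sub>1 \<Gamma>\<^sub>2)"

text \<open>\<open>direct_decomposition \<Gamma> D\<close> says that \<open>\<Gamma> = \<Gamma>\<^sub>1 \<oplus> \<dots> \<oplus> \<Gamma>\<^sub>l\<close> where \<open>D = {\<Gamma>\<^sub>1, \<dots>, \<Gamma>\<^sub>l}\<close>.
  Decompositions are thus considered up to the order of the summands.\<close>

definition direct_decomposition ::
    "('a, 'i) pregeom \<Rightarrow> ('a, 'i) pregeom set \<Rightarrow> bool" where
  "direct_decomposition \<Gamma> D \<longleftrightarrow>
     (\<exists>P. partition_on (types \<Gamma>) P \<and> D = truncation \<Gamma> ` P \<and>
        (\<forall>J\<in>P. \<forall>K\<in>P. J \<noteq> K \<longrightarrow>
          (\<forall>x\<in>elems \<Gamma>. \<forall>y\<in>elems \<Gamma>.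
             type_of \<Gamma> x \<in> J \<and> type_of \<Gamma> y \<in> K \<longrightarrow> (x, y) \<in> incid \<Gamma>)))"

end

theory Submission
  imports Defs
begin

text \<open>Call two types linked if some element of one is not incident with some element of the other.
  A decomposition is a partition of the types without links between different parts, so the only
  decomposition into indecomposable summands is given by the connected components of this graph.
  If \<open>i\<close> and \<open>j\<close> are linked, then primitivity on \<open>X\<^sub>i\<close>, transitivity on \<open>X\<^sub>j\<close> and connectedness
  of the truncation to \<open>{i, j}\<close> make the elements of \<open>X\<^sub>i\<close> distinguishable by their
  neighbourhoods in \<open>X\<^sub>j\<close>. Hence the action on \<open>X\<^sub>j\<close> determines the action on \<open>X\<^sub>i\<close>, and
  following links it determines the action on the whole component.\<close>

section \<open>Truncations and links between types\<close>

lemma in_types_iff: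
  assumes "pregeometry \<Gamma>"
  shows "i \<in> types \<Gamma> \<longleftrightarrow> elems_of_type \<Gamma> i \<noteq> {}"
  using assms by (force simp: pregeometry_def elems_of_type_def)

lemma pregeometry_truncation:
  assumes "pregeometry \<Gamma>" "J \<subseteq> types \<Gamma>"
  shows "pregeometry (truncation \<Gamma> J)"
proof -
  \<comment> \<open>Surjectivity onto \<open>J\<close> is the point where
    \<open>J \<subseteq> types \<Gamma>\<close> enters.\<close>
  have "type_of (truncation \<Gamma> J) ` elems (truncation \<Gamma> J) = J"
    using assms by (auto simp: truncation_def Let_def pregeometry_def)
  then show ?thesis
    using assms
    by (auto simp: truncation_def Let_def pregeometry_def refl_on_def sym_def)
qed

text \<open>This is the linking relation of the introductory text. Distinct elements of one type are
  never incident, so without \<open>i \<noteq> j\<close> every type with two elements would be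
  linked to itself.\<close>

definition nonincident_types :: "('a, 'i) pregeom \<Rightarrow> ('i \<times> 'i) set" where
  "nonincident_types \<Gamma> =
     {(i, j). i \<noteq> j \<and> (\<exists>x\<in>elems_of_type \<Gamma> i. \<exists>y\<in>elems_of_type \<Gamma> j. (x, y) \<notin> incid \<Gamma>)}"

lemma sym_nonincident_types:
  assumes "pregeometry \<Gamma>"
  shows "sym (nonincident_types \<Gamma>)"
  using assms by (fastforce simp: nonincident_types_def pregeometry_def sym_def)

lemma nonincident_types_subset:
  assumes "pregeometry \<Gamma>"
  shows "nonincident_types \<Gamma> \<subseteq> types \<Gamma> \<times> types \<Gamma>"
  using assms by (fastforce simp: nonincident_types_def in_types_iff)

text \<open>As \<open>J\<close> and \<open>K\<close> are disjoint, a nonincident pair across them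
  has distinct types and hence yields a link. This turns the incidence condition of a direct sum
  into a condition on types alone.\<close>

lemma nonincident_types_Int_Times_empty_iff:
  assumes "J \<inter> K = {}"
  shows "nonincident_types \<Gamma> \<inter> J \<times> K = {} \<longleftrightarrow>
    (\<forall>x\<in>elems \<Gamma>. \<forall>y\<in>elems \<Gamma>. type_of \<Gamma> x \<in> J \<and> type_of \<Gamma> y \<in> K \<longrightarrow> (x, y) \<in> incid \<Gamma>)"
proof
  assume empty: "nonincident_types \<Gamma> \<inter> J \<times> K = {}"
  show "\<forall>x\<in>elems \<Gamma>. \<forall>y\<in>elems \<Gamma>. type_of \<Gamma> x \<in> J \<and> type_of \<Gamma> y \<in> K \<longrightarrow> (x, y) \<in> incid \<Gamma>"
  proof (intro ballI impI, elim conjE)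
    fix x y
    assume xy: "x \<in> elems \<Gamma>" "y \<in> elems \<Gamma>" "type_of \<Gamma> x \<in> J" "type_of \<Gamma> y \<in> K"
    then have "(type_of \<Gamma> x, type_of \<Gamma> y) \<notin> nonincident_types \<Gamma>" using empty by blast
    moreover have "type_of \<Gamma> x \<noteq> type_of \<Gamma> y" using assms xy by auto
    ultimately show "(x, y) \<in> incid \<Gamma>"
      using xy by (auto simp: nonincident_types_def elems_of_type_def)
  qed
qed (auto simp: nonincident_types_def elems_of_type_def)

text \<open>The summands have disjoint type sets, so all elements of a type lie in the same summand
  and the sum is governed by a splitting of \<open>J\<close>. Conversely, the truncations to the two
  halves serve as summands.\<close>

lemma decomposable_truncation_iff:
  assumes "pregeometry \<Gamma>" "J \<subseteq> types \<Gamma>"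
  shows "decomposable (truncation \<Gamma> J) \<longleftrightarrow>
    (\<exists>J\<^sub>1 J\<^sub>2. J = J\<^sub>1 \<union> J\<^sub>2 \<and> J\<^sub>1 \<noteq> {} \<and> J\<^sub>2 \<noteq> {} \<and> J\<^sub>1 \<inter> J\<^sub>2 = {} \<and>
       nonincident_types \<Gamma> \<inter> J\<^sub>1 \<times> J\<^sub>2 = {})"
    (is "_ \<longleftrightarrow> (\<exists>J\<^sub>1 J\<^sub>2. ?split J\<^sub>1 J\<^sub>2)")
proof
  assume "decomposable (truncation \<Gamma> J)"
  then obtain \<Gamma>\<^sub>1 \<Gamma>\<^sub>2 where pre: "pregeometry \<Gamma>\<^sub>1" "pregeometry \<Gamma>\<^sub>2"
    and ne: "elems \<Gamma>\<^sub>1 \<noteq> {}" "elems \<Gamma>\<^sub>2 \<noteq> {}"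
    and disj: "elems \<Gamma>\<^sub>1 \<inter> elems \<Gamma>\<^sub>2 = {}" "types \<Gamma>\<^sub>1 \<inter> types \<Gamma>\<^sub>2 = {}"
    and eq: "truncation \<Gamma> J = direct_sum \<Gamma>\<^sub>1 \<Gamma>\<^sub>2"
    by (auto simp: decomposable_def)
  have types: "J = types \<Gamma>\<^sub>1 \<union> types \<Gamma>\<^sub>2"
    using arg_cong[OF eq, of types] by (simp add: truncation_def direct_sum_def Let_def)
  have elems: "{x \<in> elems \<Gamma>. type_of \<Gamma> x \<in> J} = elems \<Gamma>\<^sub>1 \<union> elems \<Gamma>\<^sub>2"
    using arg_cong[OF eq, of elems] by (simp add: truncation_def direct_sum_def Let_def)
  have type_of: "type_of \<Gamma> x = (if x \<in> elems \<Gamma>\<^sub>1 then type_of \<Gamma>\<^sub>1 x else type_of \<Gamma>\<^sub>2 x)"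
    if "x \<in> elems \<Gamma>\<^sub>1 \<union> elems \<Gamma>\<^sub>2" for x
    using fun_cong[OF arg_cong[OF eq, of type_of], of x] that
    by (simp add: truncation_def direct_sum_def Let_def elems)
  have incid: "elems \<Gamma>\<^sub>1 \<times> elems \<Gamma>\<^sub>2 \<subseteq> incid \<Gamma>"
    using arg_cong[OF eq, of incid] by (auto simp: truncation_def direct_sum_def Let_def)
  \<comment> \<open>Nonempty element sets thereby give nonempty halves of \<open>J\<close>.\<close>
  have img: "types \<Gamma>\<^sub>1 = type_of \<Gamma>\<^sub>1 ` elems \<Gamma>\<^sub>1" "types \<Gamma>\<^sub>2 = type_of \<Gamma>\<^sub>2 ` elems \<Gamma>\<^sub>2"
    using pre by (simp_all add: pregeometry_def)
  have 1: "elems_of_type \<Gamma> i \<subseteq> elems \<Gamma>\<^sub>1" if "i \<in> types \<Gamma>\<^sub>1" for i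
  proof
    fix x assume x: "x \<in> elems_of_type \<Gamma> i"
    then have "x \<in> elems \<Gamma>\<^sub>1 \<union> elems \<Gamma>\<^sub>2"
      using that types elems by (auto simp: elems_of_type_def)
    moreover have "x \<notin> elems \<Gamma>\<^sub>2"
    proof
      assume "x \<in> elems \<Gamma>\<^sub>2"
      then have "type_of \<Gamma> x \<in> types \<Gamma>\<^sub>2"
        using type_of[of x] img disj(1) by auto
      then show False using x that disj(2) by (auto simp: elems_of_type_def)
    qed
    ultimately show "x \<in> elems \<Gamma>\<^sub>1" by blast
  qed
  have 2: "elems_of_type \<Gamma> i \<subseteq> elems \<Gamma>\<^sub>2" if "i \<in> types \<Gamma>\<^sub>2" for i
  proof
    fix x assume x: "x \<in> elems_of_type \<Gamma> i"
    then have "x \<in> elems \<Gamma>\<^sub>1 \<union> elems \<Gamma>\<^sub>2"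
      using that types elems by (auto simp: elems_of_type_def)
    moreover have "x \<notin> elems \<Gamma>\<^sub>1"
    proof
      assume "x \<in> elems \<Gamma>\<^sub>1"
      then have "type_of \<Gamma> x \<in> types \<Gamma>\<^sub>1"
        using type_of[of x] img disj(1) by auto
      then show False using x that disj(2) by (auto simp: elems_of_type_def)
    qed
    ultimately show "x \<in> elems \<Gamma>\<^sub>2" by blast
  qed
  have "nonincident_types \<Gamma> \<inter> types \<Gamma>\<^sub>1 \<times> types \<Gamma>\<^sub>2 = {}"
    using subsetD[OF 1] subsetD[OF 2] subsetD[OF incid] by (auto simp: nonincident_types_def)
  then show "\<exists>J\<^sub>1 J\<^sub>2. ?split J\<^sub>1 J\<^sub>2"
    using types disj(2) ne img by (intro exI[of _ "types \<Gamma>\<^sub>1"] exI[of _ "types \<Gamma>\<^sub>2"]) simp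
next
  assume "\<exists>J\<^sub>1 J\<^sub>2. ?split J\<^sub>1 J\<^sub>2"
  then obtain J\<^sub>1 J\<^sub>2 where J: "J = J\<^sub>1 \<union> J\<^sub>2" and ne: "J\<^sub>1 \<noteq> {}" "J\<^sub>2 \<noteq> {}"
    and disj: "J\<^sub>1 \<inter> J\<^sub>2 = {}" and nonincid: "nonincident_types \<Gamma> \<inter> J\<^sub>1 \<times> J\<^sub>2 = {}"
    by blast
  have incid: "(x, y) \<in> incid \<Gamma>" "(y, x) \<in> incid \<Gamma>"
    if "x \<in> elems \<Gamma>" "y \<in> elems \<Gamma>" "type_of \<Gamma> x \<in> J\<^sub>1" "type_of \<Gamma> y \<in> J\<^sub>2" for x y
  proof -
    show "(x, y) \<in> incid \<Gamma>"
      using nonincid that by (simp add: nonincident_types_Int_Times_empty_iff[OF disj])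
    then show "(y, x) \<in> incid \<Gamma>"
      using assms(1) by (auto simp: pregeometry_def sym_def)
  qed
  have "truncation \<Gamma> J = direct_sum (truncation \<Gamma> J\<^sub>1) (truncation \<Gamma> J\<^sub>2)"
  proof (rule pregeom.equality)
    \<comment> \<open>Of the record fields, only incidence depends on the absence of links.\<close>
    show "incid (truncation \<Gamma> J) = incid (direct_sum (truncation \<Gamma> J\<^sub>1) (truncation \<Gamma> J\<^sub>2))"
      using incid by (auto simp: truncation_def direct_sum_def Let_def J)
  qed (auto simp: truncation_def direct_sum_def Let_def J)
  moreover have "elems (truncation \<Gamma> K) \<noteq> {}" if "K \<noteq> {}" "K \<subseteq> types \<Gamma>" for K
  proof -
    obtain k where "k \<in> K" using \<open>K \<noteq> {}\<close> by blast
    then have "elems_of_type \<Gamma> k \<noteq> {}" using in_types_iff[OF assms(1)] that(2) by blast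
    then show ?thesis using \<open>k \<in> K\<close> by (auto simp: truncation_def Let_def elems_of_type_def)
  qed
  moreover have "elems (truncation \<Gamma> J\<^sub>1) \<inter> elems (truncation \<Gamma> J\<^sub>2) = {}"
    "types (truncation \<Gamma> J\<^sub>1) \<inter> types (truncation \<Gamma> J\<^sub>2) = {}"
    using disj by (auto simp: truncation_def Let_def)
  moreover have "J\<^sub>1 \<subseteq> types \<Gamma>" "J\<^sub>2 \<subseteq> types \<Gamma>"
    using assms(2) J by auto
  ultimately show "decomposable (truncation \<Gamma> J)"
    unfolding decomposable_def using pregeometry_truncation[OF assms(1)] ne
    by (intro exI[of _ "truncation \<Gamma> J\<^sub>1"] exI[of _ "truncation \<Gamma> J\<^sub>2"]) simp
qed

section \<open>Components of the link graph and uniqueness of the decomposition\<close>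

definition type_components :: "('a, 'i) pregeom \<Rightarrow> 'i set set" where
  "type_components \<Gamma> = (\<lambda>i. (nonincident_types \<Gamma>)\<^sup>* `` {i}) ` types \<Gamma>"

text \<open>Links are symmetric, so reachability is an equivalence relation, and links never leave
  \<open>types \<Gamma>\<close>.\<close>

lemma type_components_partition:
  assumes "pregeometry \<Gamma>"
  shows "partition_on (types \<Gamma>) (type_components \<Gamma>)"
proof -
  let ?R = "nonincident_types \<Gamma>"
  have sym: "sym (?R\<^sup>*)"
    by (intro sym_rtrancl sym_nonincident_types assms)
  have sub: "j \<in> types \<Gamma>" if "(i, j) \<in> ?R\<^sup>*" "i \<in> types \<Gamma>" for i j
    using that nonincident_types_subset[OF assms] by induction auto
  have "?R\<^sup>* `` {i} = ?R\<^sup>* `` {j}" if "(i, k) \<in> ?R\<^sup>*" "(j, k) \<in> ?R\<^sup>*" for i j k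
    using that sym by (auto dest: symD intro: rtrancl_trans)
  then show ?thesis
    using sub unfolding type_components_def
    by (intro partition_onI) (auto simp: disjnt_def)
qed

lemma type_components_nonincident:
  assumes "J \<in> type_components \<Gamma>" "i \<in> J" "(i, j) \<in> nonincident_types \<Gamma>"
  shows "j \<in> J"
  using assms by (auto simp: type_components_def intro: rtrancl_into_rtrancl)

text \<open>Distinct parts of a partition are disjoint, so cross-incidence can be read as absence of
  links.\<close>

lemma direct_decomposition_iff:
  "direct_decomposition \<Gamma> D \<longleftrightarrow>
     (\<exists>P. partition_on (types \<Gamma>) P \<and> D = truncation \<Gamma> ` P \<and>
        (\<forall>J\<in>P. \<forall>K\<in>P. J \<noteq> K \<longrightarrow> nonincident_types \<Gamma> \<inter> J \<times> K = {}))"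
proof -
  have "(\<forall>x\<in>elems \<Gamma>. \<forall>y\<in>elems \<Gamma>.
           type_of \<Gamma> x \<in> J \<and> type_of \<Gamma> y \<in> K \<longrightarrow> (x, y) \<in> incid \<Gamma>) \<longleftrightarrow>
         nonincident_types \<Gamma> \<inter> J \<times> K = {}"
    if "partition_on (types \<Gamma>) P" "J \<in> P" "K \<in> P" "J \<noteq> K" for P J K
  proof -
    have "J \<inter> K = {}"
      using partition_onD2[OF that(1)] that(2-) by (auto simp: disjoint_def)
    then show ?thesis by (rule nonincident_types_Int_Times_empty_iff[symmetric])
  qed
  then show ?thesis
    unfolding direct_decomposition_def by (intro ex_cong1) metis
qed

lemma direct_decomposition_type_components:
  assumes "pregeometry \<Gamma>"
  shows "direct_decomposition \<Gamma> (truncation \<Gamma> ` type_components \<Gamma>)"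
  unfolding direct_decomposition_iff
proof (intro exI conjI ballI impI)
  show part: "partition_on (types \<Gamma>) (type_components \<Gamma>)"
    by (rule type_components_partition[OF assms])
  fix J K assume "J \<in> type_components \<Gamma>" "K \<in> type_components \<Gamma>" "J \<noteq> K"
  then have "J \<inter> K = {}"
    using partition_onD2[OF part] by (auto simp: disjoint_def)
  then show "nonincident_types \<Gamma> \<inter> J \<times> K = {}"
    using type_components_nonincident[OF \<open>J \<in> type_components \<Gamma>\<close>] by blast
qed simp

text \<open>A splitting without links across would trap every path that starts in one half, whereas
  any two types of a component are joined by a path.\<close>

lemma indecomposable_type_component:
  assumes "pregeometry \<Gamma>" "J \<in> type_components \<Gamma>"
  shows "\<not> decomposable (truncation \<Gamma> J)"
proof
  have sub: "J \<subseteq> types \<Gamma>"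
    using partition_onD1[OF type_components_partition[OF assms(1)]] assms(2) by blast
  assume "decomposable (truncation \<Gamma> J)"
  then obtain J\<^sub>1 J\<^sub>2 where J: "J = J\<^sub>1 \<union> J\<^sub>2" and ne: "J\<^sub>1 \<noteq> {}" "J\<^sub>2 \<noteq> {}" and disj: "J\<^sub>1 \<inter> J\<^sub>2 = {}"
    and nonincid: "nonincident_types \<Gamma> \<inter> J\<^sub>1 \<times> J\<^sub>2 = {}"
    unfolding decomposable_truncation_iff[OF assms(1) sub] by blast
  obtain i j where ij: "i \<in> J\<^sub>1" "j \<in> J\<^sub>2" using ne by blast
  have "sym ((nonincident_types \<Gamma>)\<^sup>*)"
    by (intro sym_rtrancl sym_nonincident_types assms)
  then have "(i, j) \<in> (nonincident_types \<Gamma>)\<^sup>*"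
    using ij J assms(2) by (auto simp: type_components_def dest: symD intro: rtrancl_trans)
  then have "j \<in> J\<^sub>1"
  proof induction
    case (step k l)
    then show ?case
      using type_components_nonincident[OF assms(2), of k l] J nonincid by blast
  qed (rule ij)
  with ij disj show False by blast
qed

text \<open>Each part is closed under links, so it contains the component of each of its types. A
  part larger than one component would split into that component and the rest, and its truncation
  would be decomposable.\<close>

lemma indecomposable_decomposition_unique:
  assumes \<Gamma>: "pregeometry \<Gamma>" and D: "direct_decomposition \<Gamma> D"
    and indec: "\<And>\<Delta>. \<Delta> \<in> D \<Longrightarrow> \<not> decomposable \<Delta>"
  shows "D = truncation \<Gamma> ` type_components \<Gamma>"
proof -
  obtain P where P: "partition_on (types \<Gamma>) P" and D: "D = truncation \<Gamma> ` P"
    and cross: "\<And>J K. J \<in> P \<Longrightarrow> K \<in> P \<Longrightarrow> J \<noteq> K \<Longrightarrow> nonincident_types \<Gamma> \<inter> J \<times> K = {}"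
    using D unfolding direct_decomposition_iff by blast
  have component: "J = (nonincident_types \<Gamma>)\<^sup>* `` {i}" (is "J = ?C") if "J \<in> P" "i \<in> J" for i J
  proof
    have closed: "k \<in> J" if jk: "j \<in> J" "(j, k) \<in> nonincident_types \<Gamma>" for j k
    proof -
      obtain K where "K \<in> P" "k \<in> K"
        using jk(2) nonincident_types_subset[OF \<Gamma>] partition_onD1[OF P] by blast
      then show ?thesis using cross[OF \<open>J \<in> P\<close>] jk by blast
    qed
    have "j \<in> J" if "(i, j) \<in> (nonincident_types \<Gamma>)\<^sup>*" for j
      using that by induction (auto intro: closed \<open>i \<in> J\<close>)
    then show sub: "?C \<subseteq> J" by blast
    show "J \<subseteq> ?C"
    proof (rule ccontr)
      assume "\<not> J \<subseteq> ?C"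
      \<comment> \<open>A link starting in \<open>?C\<close> ends in \<open>?C\<close>, because
        \<open>?C\<close> is a reachability class.\<close>
      moreover have "nonincident_types \<Gamma> \<inter> ?C \<times> (J - ?C) = {}"
        by (auto intro: rtrancl_into_rtrancl)
      moreover have "J \<subseteq> types \<Gamma>" using \<open>J \<in> P\<close> partition_onD1[OF P] by blast
      moreover have "?C \<noteq> {}" "J = ?C \<union> (J - ?C)" "J - ?C \<noteq> {}" "?C \<inter> (J - ?C) = {}"
        using sub \<open>\<not> J \<subseteq> ?C\<close> by blast+
      ultimately have "decomposable (truncation \<Gamma> J)"
        using decomposable_truncation_iff[OF \<Gamma>, of J] by meson
      then show False using indec D \<open>J \<in> P\<close> by blast
    qed
  qed
  have "P = type_components \<Gamma>"
  proof
    show "P \<subseteq> type_components \<Gamma>"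
    proof
      fix J assume "J \<in> P"
      then have "J \<noteq> {}" using partition_onD3[OF P] by metis
      then obtain i where "i \<in> J" by blast
      moreover from this have "i \<in> types \<Gamma>"
        using \<open>J \<in> P\<close> partition_onD1[OF P] by blast
      ultimately show "J \<in> type_components \<Gamma>"
        using component[OF \<open>J \<in> P\<close>] by (auto simp: type_components_def)
    qed
    show "type_components \<Gamma> \<subseteq> P"
      using component partition_onD1[OF P] by (fastforce simp: type_components_def)
  qed
  then show ?thesis by (simp add: D)
qed

section \<open>Restricting permutation groups to invariant sets\<close>

text \<open>Stated for an arbitrary ambient set \<open>Y\<close> so that it can be applied twice:
  first to restrict \<open>G\<close> to the elements of a component, then to restrict the resulting
  group to one type.\<close>

lemma group_action_restrict:
  assumes K: "subgroup K (BijGroup Y)" and "Z \<subseteq> Y" and inv: "\<And>g. g \<in> K \<Longrightarrow> g ` Z = Z"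
  shows "group_action ((BijGroup Y)\<lparr>carrier := K\<rparr>) Z (restr_action Z)"
proof -
  have Bij: "g \<in> Bij Y" if "g \<in> K" for g
    using subgroup.mem_carrier[OF K that] by (simp add: BijGroup_def)
  have restr: "restrict g Z \<in> Bij Z" if "g \<in> K" for g
    using Bij[OF that] inv[OF that] \<open>Z \<subseteq> Y\<close>
    by (auto simp: Bij_def bij_betw_def intro: inj_on_subset)
  \<comment> \<open>Invariance under \<open>h\<close> keeps \<open>h z\<close> in \<open>Z\<close>,
    where \<open>restrict g Z\<close> agrees with \<open>g\<close>.\<close>
  have "restrict (compose Y g h) Z = compose Z (restrict g Z) (restrict h Z)"
    if "g \<in> K" "h \<in> K" for g h
    using inv[OF that(2)] \<open>Z \<subseteq> Y\<close> by (auto simp: compose_def restrict_def fun_eq_iff)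
  then have "restr_action Z \<in> hom ((BijGroup Y)\<lparr>carrier := K\<rparr>) (BijGroup Z)"
    using restr Bij by (auto simp: hom_def BijGroup_def)
  then show ?thesis
    using K group_BijGroup
    by (auto simp: group_action_def group_hom_def group_hom_axioms_def
        intro: subgroup.subgroup_is_group)
qed

section \<open>Primitive-basic pregeometries and their neighbourhoods\<close>

text \<open>\<open>G\<close> is placed inside the full symmetric group because
  \<open>group_action_restrict\<close> expects a subgroup of some \<open>BijGroup\<close>.\<close>

locale primitive_basic_pregeometry =
  fixes \<Gamma> :: "('a, 'i) pregeom" and G :: "('a \<Rightarrow> 'a) set"
  assumes pregeometry: "pregeometry \<Gamma>"
    and connected: "rank2_truncations_connected \<Gamma>"
    and subgroup: "subgroup G (BijGroup (elems \<Gamma>))"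
    and G_Aut: "G \<subseteq> carrier (Aut \<Gamma>)"
    and primitive_basic: "primitive_basic G \<Gamma>"
begin

lemma G_type_of: "g \<in> G \<Longrightarrow> x \<in> elems \<Gamma> \<Longrightarrow> type_of \<Gamma> (g x) = type_of \<Gamma> x"
  using G_Aut by (auto simp: Aut_def)

lemma G_incid:
  "g \<in> G \<Longrightarrow> x \<in> elems \<Gamma> \<Longrightarrow> y \<in> elems \<Gamma> \<Longrightarrow> (g x, g y) \<in> incid \<Gamma> \<longleftrightarrow> (x, y) \<in> incid \<Gamma>"
  using G_Aut by (auto simp: Aut_def)

lemma G_inj_on: "g \<in> G \<Longrightarrow> inj_on g (elems \<Gamma>)"
  using G_Aut by (auto simp: Aut_def Bij_def bij_betw_def)

lemma G_image:
  assumes "g \<in> G"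
  shows "g ` {x \<in> elems \<Gamma>. type_of \<Gamma> x \<in> J} = {x \<in> elems \<Gamma>. type_of \<Gamma> x \<in> J}"
\<comment> \<open>On a finite set an injection into itself is onto, so the inclusion
  suffices.\<close>
proof (rule endo_inj_surj)
  show "finite {x \<in> elems \<Gamma>. type_of \<Gamma> x \<in> J}"
    using pregeometry by (simp add: pregeometry_def)
  show "inj_on g {x \<in> elems \<Gamma>. type_of \<Gamma> x \<in> J}"
    using G_inj_on[OF assms] by (rule inj_on_subset) auto
  have "g x \<in> elems \<Gamma>" if "x \<in> elems \<Gamma>" for x
    using assms that subsetD[OF G_Aut assms] by (auto simp: Aut_def dest: Bij_imp_funcset)
  then show "g ` {x \<in> elems \<Gamma>. type_of \<Gamma> x \<in> J} \<subseteq> {x \<in> elems \<Gamma>. type_of \<Gamma> x \<in> J}"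
    using G_type_of[OF assms] by auto
qed

lemma G_image_elems_of_type: "g \<in> G \<Longrightarrow> g ` elems_of_type \<Gamma> i = elems_of_type \<Gamma> i"
  using G_image[of g "{i}"] by (simp add: elems_of_type_def)

text \<open>Available because \<open>primitive_action\<close> extends
  \<open>transitive_action\<close>.\<close>

lemma transitive:
  assumes "i \<in> types \<Gamma>" "x \<in> elems_of_type \<Gamma> i" "y \<in> elems_of_type \<Gamma> i"
  obtains g where "g \<in> G" "g x = y"
proof -
  interpret primitive_action "induced_group G (elems_of_type \<Gamma> i)" "elems_of_type \<Gamma> i"
    "restr_action (elems_of_type \<Gamma> i)"
    using primitive_basic assms(1) by (simp add: primitive_basic_def)
  show thesis
    using unique_orbit[OF assms(2,3)] assms(2) that by (auto simp: induced_group_def)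
qed

text \<open>Primitivity, transferred from the induced group to \<open>G\<close> itself: a block lies
  within its type, so restricting \<open>g\<close> does not change the image of the block.\<close>

lemma invariant_partition:
  assumes "i \<in> types \<Gamma>" "partition_on (elems_of_type \<Gamma> i) P"
    and "\<And>g B. g \<in> G \<Longrightarrow> B \<in> P \<Longrightarrow> g ` B \<in> P"
  shows "P = {elems_of_type \<Gamma> i} \<or> P = (\<lambda>x. {x}) ` elems_of_type \<Gamma> i"
proof -
  interpret primitive_action "induced_group G (elems_of_type \<Gamma> i)" "elems_of_type \<Gamma> i"
    "restr_action (elems_of_type \<Gamma> i)"
    using primitive_basic assms(1) by (simp add: primitive_basic_def)
  show ?thesis
  proof (rule primitive[OF assms(2)])
    fix g B assume g: "g \<in> carrier (induced_group G (elems_of_type \<Gamma> i))" and B: "B \<in> P"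
    then obtain h where h: "h \<in> G" "g = restrict h (elems_of_type \<Gamma> i)"
      by (auto simp: induced_group_def)
    have "restrict g (elems_of_type \<Gamma> i) ` B = h ` B"
      using B partition_onD1[OF assms(2)] h(2) by (intro image_cong) auto
    then show "restrict g (elems_of_type \<Gamma> i) ` B \<in> P"
      using assms(3)[OF h(1) B] by simp
  qed
qed

definition nbrs :: "'i \<Rightarrow> 'a \<Rightarrow> 'a set" where
  "nbrs j x = {y \<in> elems_of_type \<Gamma> j. (x, y) \<in> incid \<Gamma>}"

text \<open>Each \<open>g\<close> permutes the elements of type \<open>j\<close> and preserves
  incidence in both directions.\<close>

lemma nbrs_image:
  assumes "g \<in> G" "x \<in> elems \<Gamma>"
  shows "nbrs j (g x) = g ` nbrs j x"
proof -
  have "nbrs j (g x) = {y \<in> g ` elems_of_type \<Gamma> j. (g x, y) \<in> incid \<Gamma>}"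
    by (simp add: nbrs_def G_image_elems_of_type[OF assms(1)])
  also have "\<dots> = g ` nbrs j x"
    using G_incid[OF assms] by (auto simp: nbrs_def elems_of_type_def)
  finally show ?thesis .
qed

text \<open>A path in the connected truncation from \<open>x\<close> to an element of type
  \<open>j\<close> starts with an edge at \<open>x\<close>. Edges join different types, so the other
  end of that edge has type \<open>j\<close>.\<close>

lemma exists_nbr:
  assumes "(i, j) \<in> nonincident_types \<Gamma>" "x \<in> elems_of_type \<Gamma> i"
  shows "nbrs j x \<noteq> {}"
proof -
  let ?T = "truncation \<Gamma> {i, j}"
  obtain y where y: "y \<in> elems_of_type \<Gamma> j" and "i \<noteq> j"
    using assms(1) by (auto simp: nonincident_types_def)
  have "i \<in> types \<Gamma>" "j \<in> types \<Gamma>"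
    using assms(1) nonincident_types_subset[OF pregeometry] by auto
  then have "incidence_graph_connected ?T"
    using connected \<open>i \<noteq> j\<close> by (simp add: rank2_truncations_connected_def)
  then have "(x, y) \<in> (incidence_edges ?T)\<^sup>*"
    using assms(2) y
    by (auto simp: incidence_graph_connected_def truncation_def Let_def elems_of_type_def)
  moreover have "x \<noteq> y"
    using assms(2) y \<open>i \<noteq> j\<close> by (auto simp: elems_of_type_def)
  ultimately obtain z where "(x, z) \<in> incidence_edges ?T"
    by (meson converse_rtranclE)
  then have "z \<in> nbrs j x"
    using assms(2)
    by (auto simp: incidence_edges_def truncation_def Let_def nbrs_def elems_of_type_def)
  then show ?thesis by blast
qed

text \<open>The fibres of \<open>nbrs j\<close> form an invariant partition, so by primitivity either \<open>nbrs j\<close> is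
  injective or its only value is an invariant set, hence empty or everything by transitivity.\<close>

lemma inj_on_nbrs:
  assumes nonincid: "(i, j) \<in> nonincident_types \<Gamma>"
  shows "inj_on (nbrs j) (elems_of_type \<Gamma> i)"
proof -
  let ?X = "elems_of_type \<Gamma> i"
  define fibre where "fibre x = {y \<in> ?X. nbrs j y = nbrs j x}" for x
  have ij: "i \<in> types \<Gamma>" "j \<in> types \<Gamma>"
    using assms(1) nonincident_types_subset[OF pregeometry] by auto
  have elems: "x \<in> elems \<Gamma>" if "x \<in> elems_of_type \<Gamma> k" for x k
    using that by (simp add: elems_of_type_def)
  have "partition_on ?X (fibre ` ?X)"
    by (rule partition_onI) (auto simp: fibre_def disjnt_def)
  moreover have "g ` B \<in> fibre ` ?X" if g: "g \<in> G" and "B \<in> fibre ` ?X" for g B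
  proof -
    obtain x where x: "x \<in> ?X" "B = fibre x" using \<open>B \<in> fibre ` ?X\<close> by blast
    \<comment> \<open>Having equal neighbourhoods is preserved by \<open>g\<close>, since
      \<open>g\<close> is injective and thus also injective on subsets of
      \<open>elems \<Gamma>\<close>.\<close>
    have inj: "nbrs j (g y) = nbrs j (g x) \<longleftrightarrow> nbrs j y = nbrs j x" if "y \<in> ?X" for y
    proof -
      have "nbrs j y \<subseteq> elems \<Gamma>" for y by (auto simp: nbrs_def elems)
      then show ?thesis
        using that x(1) by (simp add: nbrs_image g elems inj_on_image_eq_iff[OF G_inj_on[OF g]])
    qed
    have "fibre (g x) = {y \<in> g ` ?X. nbrs j y = nbrs j (g x)}"
      by (simp add: fibre_def G_image_elems_of_type[OF g])
    also have "\<dots> = g ` fibre x"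
      using inj by (auto simp: fibre_def)
    finally show ?thesis
      using x G_image_elems_of_type[OF g, of i] by blast
  qed
  ultimately consider "fibre ` ?X = {?X}" | "fibre ` ?X = (\<lambda>x. {x}) ` ?X"
    using invariant_partition[OF ij(1)] by metis
  then show ?thesis
  proof cases
    case 1
    have const: "nbrs j y = nbrs j x" if "x \<in> ?X" "y \<in> ?X" for x y
    proof -
      have "fibre x = ?X" using 1 that(1) by blast
      then show ?thesis using that(2) by (auto simp: fibre_def)
    qed
    obtain x y where xy: "x \<in> ?X" "y \<in> elems_of_type \<Gamma> j" "(x, y) \<notin> incid \<Gamma>"
      using nonincid by (auto simp: nonincident_types_def)
    obtain z where z: "z \<in> nbrs j x"
      using exists_nbr[OF nonincid xy(1)] by blast
    \<comment> \<open>Moving the neighbour \<open>z\<close> of \<open>x\<close> to the non-neighbour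
      \<open>y\<close> contradicts the constancy of \<open>nbrs j\<close>.\<close>
    then obtain g where g: "g \<in> G" "g z = y"
      using transitive[OF ij(2) _ xy(2), of z] by (auto simp: nbrs_def)
    have "y \<in> nbrs j (g x)"
      using z g by (auto simp: nbrs_image elems[OF xy(1)])
    moreover have "g x \<in> ?X" using xy(1) G_image_elems_of_type[OF g(1), of i] by blast
    ultimately have "y \<in> nbrs j x" using const[OF xy(1)] by simp
    then show ?thesis using xy by (simp add: nbrs_def)
  next
    case 2
    show ?thesis
    proof (rule inj_onI)
      fix x y assume xy: "x \<in> ?X" "y \<in> ?X" "nbrs j x = nbrs j y"
      then have "x \<in> fibre x" "y \<in> fibre x" by (simp_all add: fibre_def)
      moreover obtain z where "fibre x = {z}" using 2 xy(1) by blast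
      ultimately show "x = y" by simp
    qed
  qed
qed

text \<open>Agreement propagates along links: if \<open>g\<close> and \<open>h\<close> agree on type
  \<open>k\<close>, then \<open>g x\<close> and \<open>h x\<close> have the same neighbours of type
  \<open>k\<close>, and for a type linked to \<open>k\<close> such elements coincide.\<close>

lemma agree_on_component:
  assumes g: "g \<in> G" and h: "h \<in> G" and agree: "\<And>y. y \<in> elems_of_type \<Gamma> j \<Longrightarrow> g y = h y"
    and "(i, j) \<in> (nonincident_types \<Gamma>)\<^sup>*" and "x \<in> elems_of_type \<Gamma> i"
  shows "g x = h x"
  using assms(4,5)
\<comment> \<open>The path is extended at the end away from \<open>j\<close>, so the induction
  hypothesis concerns the type \<open>k\<close> next to \<open>i\<close>.\<close>
proof (induction arbitrary: x rule: converse_rtrancl_induct)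
  case base
  then show ?case by (rule agree)
next
  case (step i k)
  have x: "x \<in> elems \<Gamma>" using step.prems by (simp add: elems_of_type_def)
  have "nbrs k (g x) = g ` nbrs k x" by (rule nbrs_image[OF g x])
  also have "\<dots> = h ` nbrs k x"
    using step.IH by (intro image_cong) (auto simp: nbrs_def)
  also have "\<dots> = nbrs k (h x)" by (rule nbrs_image[OF h x, symmetric])
  finally have "nbrs k (g x) = nbrs k (h x)" .
  moreover have "g x \<in> elems_of_type \<Gamma> i" "h x \<in> elems_of_type \<Gamma> i"
    using step.prems G_image_elems_of_type[of _ i] g h by blast+
  ultimately show ?case by (rule inj_onD[OF inj_on_nbrs[OF step.hyps(1)]])
qed

section \<open>The group induced on a component\<close>

context
  fixes J j
  assumes J: "J \<in> type_components \<Gamma>" and j: "j \<in> J"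
begin

lemma types_j: "j \<in> types \<Gamma>"
  using J j partition_onD1[OF type_components_partition[OF pregeometry]] by blast

lemma group_action_component:
  "group_action (induced_group G (elems (truncation \<Gamma> J))) (elems_of_type \<Gamma> j)
     (restr_action (elems_of_type \<Gamma> j))"
proof -
  let ?Y = "elems (truncation \<Gamma> J)" and ?X = "elems_of_type \<Gamma> j"
  have Y: "g ` ?Y = ?Y" if "g \<in> G" for g
    using G_image[OF that] by (simp add: truncation_def Let_def)
  have "?Y \<subseteq> elems \<Gamma>" by (auto simp: truncation_def Let_def)
  then interpret Y: group_action "(BijGroup (elems \<Gamma>))\<lparr>carrier := G\<rparr>" ?Y "restr_action ?Y"
    using Y by (intro group_action_restrict subgroup)
  \<comment> \<open>As the image of a homomorphism, the group induced on the component is again a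
    permutation group, so the restriction lemma applies once more.\<close>
  have "subgroup (restr_action ?Y ` G) (BijGroup ?Y)"
    using group_hom.img_is_subgroup[OF Y.group_hom] by simp
  moreover have XY: "?X \<subseteq> ?Y" using j by (auto simp: truncation_def Let_def elems_of_type_def)
  moreover have "g ` ?X = ?X" if g: "g \<in> restr_action ?Y ` G" for g
  proof -
    obtain h where "h \<in> G" "g = restrict h ?Y" using g by blast
    then have "g ` ?X = h ` ?X" using XY by (intro image_cong) auto
    then show ?thesis using G_image_elems_of_type[OF \<open>h \<in> G\<close>] by simp
  qed
  ultimately show ?thesis
    unfolding induced_group_def by (rule group_action_restrict)
qed

text \<open>Every type of the component is joined to \<open>j\<close> by links, so the action on
  type \<open>j\<close> determines the action on the whole component.\<close>

lemma faithful_action_component: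
  "faithful_action (induced_group G (elems (truncation \<Gamma> J))) (elems_of_type \<Gamma> j)
     (restr_action (elems_of_type \<Gamma> j))"
proof -
  let ?Y = "elems (truncation \<Gamma> J)" and ?X = "elems_of_type \<Gamma> j"
  have XY: "?X \<subseteq> ?Y" using j by (auto simp: truncation_def Let_def elems_of_type_def)
  have reach: "(i, j) \<in> (nonincident_types \<Gamma>)\<^sup>*" if "i \<in> J" for i
    using that J j sym_rtrancl[OF sym_nonincident_types[OF pregeometry]]
    by (auto simp: type_components_def dest: symD intro: rtrancl_trans)
  \<comment> \<open>Faithfulness is encoded as injectivity of the action map on the carrier.\<close>
  have "inj_on (restr_action ?X) (restr_action ?Y ` G)"
  proof (rule inj_onI, clarify)
    fix g h assume gh: "g \<in> G" "h \<in> G"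
      and eq: "restrict (restrict g ?Y) ?X = restrict (restrict h ?Y) ?X"
    have agree: "g y = h y" if "y \<in> ?X" for y
      using fun_cong[OF eq, of y] that XY by auto
    have "g x = h x" if "x \<in> ?Y" for x
    proof (rule agree_on_component[OF gh agree reach])
      show "type_of \<Gamma> x \<in> J" "x \<in> elems_of_type \<Gamma> (type_of \<Gamma> x)"
        using that by (simp_all add: truncation_def Let_def elems_of_type_def)
    qed
    then show "restrict g ?Y = restrict h ?Y" by (rule restrict_ext)
  qed
  then show ?thesis
    using group_action_component
    by (simp add: faithful_action_def faithful_action_axioms_def induced_group_def)
qed

text \<open>On elements of type \<open>j\<close> the group induced on the component acts by the same
  maps as \<open>G\<close>, so transitivity and primitivity carry over.\<close>

lemma primitive_action_component:
  "primitive_action (induced_group G (elems (truncation \<Gamma> J))) (elems_of_type \<Gamma> j)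
     (restr_action (elems_of_type \<Gamma> j))"
proof -
  let ?Y = "elems (truncation \<Gamma> J)" and ?X = "elems_of_type \<Gamma> j"
  have XY: "?X \<subseteq> ?Y" using j by (auto simp: truncation_def Let_def elems_of_type_def)
  show ?thesis
  proof (intro primitive_action.intro transitive_action.intro group_action_component
      transitive_action_axioms.intro primitive_action_axioms.intro)
    fix x y assume xy: "x \<in> ?X" "y \<in> ?X"
    then obtain g where "g \<in> G" "g x = y" by (rule transitive[OF types_j])
    then show "\<exists>g\<in>carrier (induced_group G ?Y). restrict g ?X x = y"
      using xy XY by (auto simp: induced_group_def)
  next
    fix P assume P: "partition_on ?X P"
      and inv: "\<And>g B. g \<in> carrier (induced_group G ?Y) \<Longrightarrow> B \<in> P \<Longrightarrow> restrict g ?X ` B \<in> P"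
    have "g ` B \<in> P" if "g \<in> G" "B \<in> P" for g B
    proof -
      have "B \<subseteq> ?X" using \<open>B \<in> P\<close> partition_onD1[OF P] by blast
      then have "restrict (restrict g ?Y) ?X ` B = g ` B"
        using XY by (intro image_cong) auto
      then show ?thesis using inv[of "restrict g ?Y" B] that by (simp add: induced_group_def)
    qed
    then show "P = {?X} \<or> P = (\<lambda>x. {x}) ` ?X"
      by (rule invariant_partition[OF types_j P])
  qed
qed

end

end

section \<open>Existence and uniqueness of the decomposition\<close>

theorem theorem1p1:
  fixes \<Gamma> :: "('a, 'i) pregeom" and G :: "('a \<Rightarrow> 'a) set"
  assumes "pregeometry \<Gamma>"
    and "rank2_truncations_connected \<Gamma>"
    and "subgroup G (Aut \<Gamma>)"
    and "\<And>i. i \<in> types \<Gamma> \<Longrightarrow>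
           transitive_action ((Aut \<Gamma>)\<lparr>carrier := G\<rparr>) (elems_of_type \<Gamma> i)
             (restr_action (elems_of_type \<Gamma> i))"
    and "primitive_basic G \<Gamma>"
  shows "\<exists>!D. direct_decomposition \<Gamma> D \<and>
           (\<forall>\<Delta>\<in>D. \<not> decomposable \<Delta> \<and>
              (\<forall>j\<in>types \<Delta>.
                 faithful_action (induced_group G (elems \<Delta>)) (elems_of_type \<Delta> j)
                   (restr_action (elems_of_type \<Delta> j)) \<and>
                 primitive_action (induced_group G (elems \<Delta>)) (elems_of_type \<Delta> j)
                   (restr_action (elems_of_type \<Delta> j))))"
proof (rule ex1I[of _ "truncation \<Gamma> ` type_components \<Gamma>"])
  show "direct_decomposition \<Gamma> (truncation \<Gamma> ` type_components \<Gamma>) \<and>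
    (\<forall>\<Delta>\<in>truncation \<Gamma> ` type_components \<Gamma>. \<not> decomposable \<Delta> \<and>
       (\<forall>j\<in>types \<Delta>.
          faithful_action (induced_group G (elems \<Delta>)) (elems_of_type \<Delta> j)
            (restr_action (elems_of_type \<Delta> j)) \<and>
          primitive_action (induced_group G (elems \<Delta>)) (elems_of_type \<Delta> j)
            (restr_action (elems_of_type \<Delta> j))))"
  proof (intro conjI ballI direct_decomposition_type_components assms(1))
    fix \<Delta> assume "\<Delta> \<in> truncation \<Gamma> ` type_components \<Gamma>"
    then obtain J where J: "J \<in> type_components \<Gamma>" and \<Delta>: "\<Delta> = truncation \<Gamma> J" by blast
    show "\<not> decomposable \<Delta>"
      unfolding \<Delta> by (rule indecomposable_type_component[OF assms(1) J])
    fix j assume "j \<in> types \<Delta>"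
    then have j: "j \<in> J" by (simp add: \<Delta> truncation_def Let_def)
    then have "j \<in> types \<Gamma>"
      using J partition_onD1[OF type_components_partition[OF assms(1)]] by blast
    then interpret X: transitive_action "(Aut \<Gamma>)\<lparr>carrier := G\<rparr>" "elems_of_type \<Gamma> j"
      "restr_action (elems_of_type \<Gamma> j)"
      by (rule assms(4))
    have G_Aut: "G \<subseteq> carrier (Aut \<Gamma>)" by (rule subgroup.subset[OF assms(3)])
    \<comment> \<open>The transitive action on type \<open>j\<close> supplies that \<open>G\<close>
      is a group. \<open>Aut \<Gamma>\<close> has the multiplication of \<open>BijGroup\<close>, so
      \<open>G\<close> becomes a subgroup of the full symmetric group, as the locale
      demands.\<close>
    have "group ((BijGroup (elems \<Gamma>))\<lparr>carrier := G\<rparr>)"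
      using X.group_hom by (simp add: group_hom_def Aut_def)
    then have "subgroup G (BijGroup (elems \<Gamma>))"
      using G_Aut
      by (intro group.group_incl_imp_subgroup group_BijGroup) (auto simp: Aut_def BijGroup_def)
    then interpret primitive_basic_pregeometry \<Gamma> G
      using assms(1,2,5) G_Aut by (intro primitive_basic_pregeometry.intro)
    have "elems_of_type \<Delta> j = elems_of_type \<Gamma> j"
      using j by (auto simp: \<Delta> truncation_def Let_def elems_of_type_def)
    then show "faithful_action (induced_group G (elems \<Delta>)) (elems_of_type \<Delta> j)
        (restr_action (elems_of_type \<Delta> j))"
      "primitive_action (induced_group G (elems \<Delta>)) (elems_of_type \<Delta> j)
        (restr_action (elems_of_type \<Delta> j))"
      using faithful_action_component[OF J j] primitive_action_component[OF J j]
      by (simp_all add: \<Delta>)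
  qed
next
  fix D assume "direct_decomposition \<Gamma> D \<and> (\<forall>\<Delta>\<in>D. \<not> decomposable \<Delta> \<and>
      (\<forall>j\<in>types \<Delta>.
         faithful_action (induced_group G (elems \<Delta>)) (elems_of_type \<Delta> j)
           (restr_action (elems_of_type \<Delta> j)) \<and>
         primitive_action (induced_group G (elems \<Delta>)) (elems_of_type \<Delta> j)
           (restr_action (elems_of_type \<Delta> j))))"
  then show "D = truncation \<Gamma> ` type_components \<Gamma>"
    by (intro indecomposable_decomposition_unique assms(1)) auto
qed

end
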